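(* Let $D\ge2$, $0<k\le\lfloor D/2\rfloor$, and fix a set $I\subset\{1,\dots,D\}$ of $k$ colors, with complement $I^c$. There is a bijection between $D$-dimensional (connected) gluings of $k$-cyclic bubbles of any size with the same alternating color sets $I$ and $I^c$, and (connected) face-bipartite combinatorial maps; this bijection is the map $G\mapsto M^*(G)$ described in the context.
   Context: A $k$-cyclic bubble of size $2p$ ($p\ge1$) with alternating color sets $I$, $I^c$ is the bipartite (black/white) edge-colored graph with $2p$ vertices arranged on a cycle, consecutive vertices being joined alternately by $k$ parallel edges with all the colors of $I$ and by $D-k$ parallel edges with all the colors of $I^c$. The gluings are represented by finite connected bipartite graphs $G$ with exactly one edge of each color $0,1,\dots,D$ at each vertex, such that each component left after deleting the color-$0$ edges is such a $k$-cyclic bubble (with the fixed $I$), up to isomorphism preserving edge colors and black/white colors. A combinatorial map is a finite set of half-edges with a permutation $\sigma$ (whose cycles are the vertices) and a fixed-point-free involution $\alpha$ (whose cycles are the edges), up to relabeling; its faces are the cycles of $\sigma\circ\alpha$. A face-bipartite map is a map (with at least one edge) whose faces are colored with two colors $1$ and $2$ such that each edge is incident to one face of each color on its two sides. Construction: the half-edges of $M^*(G)$ are the vertices of $G$; each bubble, oriented from black to white along its edges with colors in $I$, gives a cycle of $\sigma$; each color-$0$ edge gives a transposition of $\alpha$. The cycles of $G$ alternating color $0$ and a color $i$ correspond to faces of $M^*(G)$, which are colored $1$ if $i\in I$ and $2$ if $i\in I^c$. *)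

theory Defs
  imports Main "HOL-Combinatorics.Combinatorics"
begin

section \<open>Edge-colored bipartite graphs\<close>

text \<open>A triple \<open>(c, b, w)\<close> in \<open>edges\<close> is an edge of color \<open>c\<close> joining the black vertex \<open>b\<close> to the
  white vertex \<open>w\<close>. Parallel edges of different colors are allowed; parallel edges of the same
  color, which this encoding cannot represent, are ruled out in all the graphs considered, as
  there is a single edge of each color at each vertex.\<close>

record 'v cgraph =
  black :: "'v set"
  white :: "'v set"
  edges :: "(nat \<times> 'v \<times> 'v) set"

definition verts :: "'v cgraph \<Rightarrow> 'v set" where
  "verts G = black G \<union> white G"

definition regular_cgraph :: "nat \<Rightarrow> 'v cgraph \<Rightarrow> bool" where
  "regular_cgraph D G \<longleftrightarrow>
     finite (black G) \<and> finite (white G) \<and> black G \<inter> white G = {} \<and>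
     edges G \<subseteq> {0..D} \<times> black G \<times> white G \<and>
     (\<forall>c\<in>{0..D}. \<forall>b\<in>black G. \<exists>!w. (c, b, w) \<in> edges G) \<and>
     (\<forall>c\<in>{0..D}. \<forall>w\<in>white G. \<exists>!b. (c, b, w) \<in> edges G)"

definition adj :: "'v cgraph \<Rightarrow> ('v \<times> 'v) set" where
  "adj G = {(u, v). \<exists>c. (c, u, v) \<in> edges G \<or> (c, v, u) \<in> edges G}"

definition connected_cgraph :: "'v cgraph \<Rightarrow> bool" where
  "connected_cgraph G \<longleftrightarrow> verts G \<noteq> {} \<and> (\<forall>u\<in>verts G. \<forall>v\<in>verts G. (u, v) \<in> (adj G)\<^sup>*)"

definition restrict_colors :: "nat set \<Rightarrow> 'v cgraph \<Rightarrow> 'v cgraph" where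
  "restrict_colors S G = \<lparr>black = black G, white = white G,
     edges = {(c, b, w). (c, b, w) \<in> edges G \<and> c \<in> S}\<rparr>"

definition induced_subgraph :: "'v cgraph \<Rightarrow> 'v set \<Rightarrow> 'v cgraph" where
  "induced_subgraph G S = \<lparr>black = black G \<inter> S, white = white G \<inter> S,
     edges = {(c, b, w). (c, b, w) \<in> edges G \<and> b \<in> S \<and> w \<in> S}\<rparr>"

definition components :: "'v cgraph \<Rightarrow> 'v cgraph set" where
  "components G = (\<lambda>v. induced_subgraph G {u \<in> verts G. (v, u) \<in> (adj G)\<^sup>*}) ` verts G"

definition cgraph_iso :: "'v cgraph \<Rightarrow> 'w cgraph \<Rightarrow> ('v \<Rightarrow> 'w) \<Rightarrow> bool" where
  "cgraph_iso G G' f \<longleftrightarrow>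
     bij_betw f (verts G) (verts G') \<and>
     f ` black G = black G' \<and> f ` white G = white G' \<and>
     (\<lambda>(c, b, w). (c, f b, f w)) ` edges G = edges G'"


section \<open>Gluings of cyclic bubbles\<close>

text \<open>The vertices are listed as \<open>v 0, \<dots>, v (2 * p - 1)\<close> around the cycle, starting from a black
  one and leaving it along its edges with colors in \<open>I\<close>. Hence the even positions are black, the
  odd ones white, \<open>v (2 * j)\<close> is joined to \<open>v (2 * j + 1)\<close> by the colors in \<open>I\<close>, and
  \<open>v (2 * j + 1)\<close> to the next vertex by the other colors. For \<open>p = 1\<close> all \<open>D\<close> edges are
  parallel.\<close>

definition cyclic_bubble :: "nat \<Rightarrow> nat set \<Rightarrow> nat \<Rightarrow> 'v cgraph \<Rightarrow> bool" where
  "cyclic_bubble D I p B \<longleftrightarrow> p \<ge> 1 \<and>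
     (\<exists>v :: nat \<Rightarrow> 'v. inj_on v {..<2 * p} \<and>
        black B = {v (2 * j) | j. j < p} \<and>
        white B = {v (2 * j + 1) | j. j < p} \<and>
        edges B =
          {(c, v (2 * j), v (2 * j + 1)) | c j. c \<in> I \<and> j < p} \<union>
          {(c, v ((2 * j + 2) mod (2 * p)), v (2 * j + 1)) | c j. c \<in> {1..D} - I \<and> j < p})"

definition gluings :: "nat \<Rightarrow> nat set \<Rightarrow> 'v cgraph set" where
  "gluings D I = {G. regular_cgraph D G \<and> connected_cgraph G \<and>
     (\<forall>B\<in>components (restrict_colors {1..D} G). \<exists>p. cyclic_bubble D I p B)}"

definition gluing_rel :: "nat \<Rightarrow> nat set \<Rightarrow> 'v cgraph rel" where
  "gluing_rel D I = {(G, G'). G \<in> gluings D I \<and> G' \<in> gluings D I \<and> (\<exists>f. cgraph_iso G G' f)}"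

lemma equiv_gluing_rel: "equiv (gluings D I) (gluing_rel D I)"
proof (rule equivI)
  show "gluing_rel D I \<subseteq> gluings D I \<times> gluings D I"
    by (auto simp: gluing_rel_def)
  have "cgraph_iso G G id" for G :: "'v cgraph"
    by (auto simp: cgraph_iso_def)
  then show "refl_on (gluings D I) (gluing_rel D I)"
    unfolding refl_on_def gluing_rel_def by blast
  show "sym (gluing_rel D I)"
  proof (rule symI)
    fix G G' :: "'v cgraph"
    assume "(G, G') \<in> gluing_rel D I"
    then obtain f where G: "G \<in> gluings D I" "G' \<in> gluings D I" and f: "cgraph_iso G G' f"
      by (auto simp: gluing_rel_def)
    define g where "g = inv_into (verts G) f"
    have inj: "inj_on f (verts G)" and bij: "bij_betw f (verts G) (verts G')"
      using f by (auto simp: cgraph_iso_def bij_betw_def)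
    have gf: "g (f x) = x" if "x \<in> verts G" for x
      unfolding g_def using inj that by (rule inv_into_f_f)
    have sub: "black G \<subseteq> verts G" "white G \<subseteq> verts G"
      by (auto simp: verts_def)
    have e: "b \<in> verts G \<and> w \<in> verts G" if "(c, b, w) \<in> edges G" for c b w
      using that G(1) by (auto simp: gluings_def regular_cgraph_def verts_def)
    have "bij_betw g (verts G') (verts G)"
      unfolding g_def by (rule bij_betw_inv_into[OF bij])
    moreover have "g ` black G' = black G" "g ` white G' = white G"
      using f inv_into_image_cancel[OF inj sub(1)] inv_into_image_cancel[OF inj sub(2)]
      by (simp_all add: cgraph_iso_def g_def)
    moreover have "(\<lambda>(c, b, w). (c, g b, g w)) ` edges G' = edges G"
    proof -
      have f': "(\<lambda>(c, b, w). (c, f b, f w)) ` edges G = edges G'"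
        using f by (simp add: cgraph_iso_def)
      have "(\<lambda>(c, b, w). (c, g b, g w)) ` edges G' =
          (\<lambda>(c, b, w). (c, g (f b), g (f w))) ` edges G"
        unfolding f'[symmetric] by (simp add: image_image case_prod_unfold)
      also have "\<dots> = (\<lambda>x. x) ` edges G"
        by (rule image_cong) (auto simp: gf dest: e)
      finally show ?thesis by simp
    qed
    ultimately have "cgraph_iso G' G g"
      by (simp add: cgraph_iso_def)
    then show "(G', G) \<in> gluing_rel D I"
      using G by (auto simp: gluing_rel_def)
  qed
  have comp: "cgraph_iso G G'' (g \<circ> f)" if "cgraph_iso G G' f" "cgraph_iso G' G'' g"
    for G G' G'' :: "'v cgraph" and f g
  proof -
    have "(\<lambda>(c, b, w). (c, (g \<circ> f) b, (g \<circ> f) w)) ` edges G =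
        (\<lambda>(c, b, w). (c, g b, g w)) ` (\<lambda>(c, b, w). (c, f b, f w)) ` edges G"
      by (simp add: image_image case_prod_unfold)
    then show ?thesis
      using that bij_betw_trans[of f "verts G" "verts G'" g "verts G''"]
      unfolding cgraph_iso_def image_comp[symmetric] by simp
  qed
  show "trans (gluing_rel D I)"
    by (rule transI) (auto simp: gluing_rel_def dest: comp)
qed


section \<open>Face-bipartite combinatorial maps\<close>

text \<open>\<open>faces1\<close> and \<open>faces2\<close> are the sets of faces of color 1 and of color 2; a face is given by the
  set of half-edges on its cycle of \<open>sigma \<circ> alpha\<close>.\<close>

record 'h fmap =
  half_edges :: "'h set"
  sigma :: "'h \<Rightarrow> 'h"
  alpha :: "'h \<Rightarrow> 'h"
  faces1 :: "'h set set"
  faces2 :: "'h set set"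

definition comb_map :: "'h fmap \<Rightarrow> bool" where
  "comb_map M \<longleftrightarrow> finite (half_edges M) \<and>
     sigma M permutes half_edges M \<and> alpha M permutes half_edges M \<and>
     (\<forall>h\<in>half_edges M. alpha M (alpha M h) = h \<and> alpha M h \<noteq> h)"

definition connected_map :: "'h fmap \<Rightarrow> bool" where
  "connected_map M \<longleftrightarrow> (\<forall>g\<in>half_edges M. \<forall>h\<in>half_edges M.
     (g, h) \<in> {(x, y). y = sigma M x \<or> x = sigma M y \<or> y = alpha M x}\<^sup>*)"

definition face :: "'h fmap \<Rightarrow> 'h \<Rightarrow> 'h set" where
  "face M h = orbit (sigma M \<circ> alpha M) h"

text \<open>The two sides of the edge \<open>{h, alpha M h}\<close> lie on \<open>face M h\<close> and \<open>face M (alpha M h)\<close>.\<close>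

definition face_bipartite :: "'h fmap \<Rightarrow> bool" where
  "face_bipartite M \<longleftrightarrow>
     faces1 M \<union> faces2 M = face M ` half_edges M \<and> faces1 M \<inter> faces2 M = {} \<and>
     (\<forall>h\<in>half_edges M.
        face M h \<in> faces1 M \<and> face M (alpha M h) \<in> faces2 M \<or>
        face M h \<in> faces2 M \<and> face M (alpha M h) \<in> faces1 M)"

definition face_bipartite_maps :: "'h fmap set" where
  "face_bipartite_maps =
     {M. comb_map M \<and> half_edges M \<noteq> {} \<and> connected_map M \<and> face_bipartite M}"

definition fmap_iso :: "'h fmap \<Rightarrow> 'g fmap \<Rightarrow> ('h \<Rightarrow> 'g) \<Rightarrow> bool" where
  "fmap_iso M M' f \<longleftrightarrow>
     bij_betw f (half_edges M) (half_edges M') \<and>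
     (\<forall>h\<in>half_edges M. f (sigma M h) = sigma M' (f h) \<and> f (alpha M h) = alpha M' (f h)) \<and>
     (\<lambda>F. f ` F) ` faces1 M = faces1 M' \<and> (\<lambda>F. f ` F) ` faces2 M = faces2 M'"

definition fmap_rel :: "'h fmap rel" where
  "fmap_rel = {(M, M'). M \<in> face_bipartite_maps \<and> M' \<in> face_bipartite_maps \<and>
     (\<exists>f. fmap_iso M M' f)}"

lemma equiv_fmap_rel: "equiv face_bipartite_maps fmap_rel"
proof (rule equivI)
  show "fmap_rel \<subseteq> face_bipartite_maps \<times> face_bipartite_maps"
    by (auto simp: fmap_rel_def)
  have "fmap_iso M M id" for M :: "'h fmap"
    by (auto simp: fmap_iso_def)
  then show "refl_on face_bipartite_maps fmap_rel"
    unfolding refl_on_def fmap_rel_def by blast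
  show "sym fmap_rel"
  proof (rule symI)
    fix M M' :: "'h fmap"
    assume "(M, M') \<in> fmap_rel"
    then obtain f where M: "M \<in> face_bipartite_maps" "M' \<in> face_bipartite_maps"
      and f: "fmap_iso M M' f"
      by (auto simp: fmap_rel_def)
    define g where "g = inv_into (half_edges M) f"
    have bij: "bij_betw f (half_edges M) (half_edges M')"
      using f by (simp add: fmap_iso_def)
    have gf: "g (f x) = x" if "x \<in> half_edges M" for x
      using bij that by (simp add: g_def bij_betw_inv_into_left)
    have perm: "sigma M permutes half_edges M" "alpha M permutes half_edges M"
      using M by (auto simp: face_bipartite_maps_def comb_map_def)
    have st: "(sigma M \<circ> alpha M) permutes half_edges M"
      using perm by (intro permutes_compose)
    have "orbit (sigma M \<circ> alpha M) h \<subseteq> half_edges M" if "h \<in> half_edges M" for h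
      using permutes_orbit_subset[OF st that] .
    then have F: "F \<subseteq> half_edges M" if "F \<in> faces1 M \<union> faces2 M" for F
    proof -
      have "F \<in> face M ` half_edges M"
        using that M(1) unfolding face_bipartite_maps_def face_bipartite_def by blast
      then show ?thesis
        using \<open>\<And>h. h \<in> half_edges M \<Longrightarrow> orbit (sigma M \<circ> alpha M) h \<subseteq> half_edges M\<close>
        by (auto simp only: face_def image_iff)
    qed
    have gF: "g ` f ` F = F" if "F \<in> faces1 M \<union> faces2 M" for F
      using inv_into_image_cancel[OF bij_betw_imp_inj_on[OF bij] F[OF that]] by (simp add: g_def)
    have "bij_betw g (half_edges M') (half_edges M)"
      unfolding g_def by (rule bij_betw_inv_into[OF bij])
    moreover have "g (sigma M' h) = sigma M (g h) \<and> g (alpha M' h) = alpha M (g h)"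
      if "h \<in> half_edges M'" for h
    proof -
      obtain x where x: "x \<in> half_edges M" "h = f x"
        using bij \<open>h \<in> half_edges M'\<close> by (auto simp: bij_betw_def)
      have "sigma M x \<in> half_edges M" "alpha M x \<in> half_edges M"
        using perm x(1) by (simp_all add: permutes_in_image)
      moreover have "sigma M' h = f (sigma M x)" "alpha M' h = f (alpha M x)"
        using f x by (auto simp: fmap_iso_def)
      ultimately show ?thesis
        using x gf by simp
    qed
    moreover have "(\<lambda>F. g ` F) ` faces1 M' = faces1 M" "(\<lambda>F. g ` F) ` faces2 M' = faces2 M"
    proof -
      have "faces1 M' = (\<lambda>F. f ` F) ` faces1 M" "faces2 M' = (\<lambda>F. f ` F) ` faces2 M"
        using f by (simp_all add: fmap_iso_def)
      moreover have "(\<lambda>F. g ` f ` F) ` faces1 M = (\<lambda>F. F) ` faces1 M"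
        "(\<lambda>F. g ` f ` F) ` faces2 M = (\<lambda>F. F) ` faces2 M"
        by (rule image_cong; simp add: gF)+
      ultimately show "(\<lambda>F. g ` F) ` faces1 M' = faces1 M" "(\<lambda>F. g ` F) ` faces2 M' = faces2 M"
        by (simp_all only: image_image image_ident)
    qed
    ultimately have "fmap_iso M' M g"
      by (simp add: fmap_iso_def)
    then show "(M', M) \<in> fmap_rel"
      using M by (auto simp: fmap_rel_def)
  qed
  have comp: "fmap_iso M M'' (g \<circ> f)" if "fmap_iso M M' f" "fmap_iso M' M'' g"
    for M M' M'' :: "'h fmap" and f g
  proof -
    have "(\<lambda>F. (g \<circ> f) ` F) ` A = (\<lambda>F. g ` F) ` (\<lambda>F. f ` F) ` A" for A
      by (simp add: image_image image_comp)
    moreover have "f h \<in> half_edges M'" if "h \<in> half_edges M" for h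
      using that \<open>fmap_iso M M' f\<close> by (auto simp: fmap_iso_def bij_betw_def)
    ultimately show ?thesis
      using that bij_betw_trans[of f "half_edges M" "half_edges M'" g "half_edges M''"]
      unfolding fmap_iso_def by simp
  qed
  show "trans fmap_rel"
    by (rule transI) (auto simp: fmap_rel_def dest: comp)
qed


section \<open>The map associated with a gluing\<close>

text \<open>\<open>bubble_succ\<close> runs around the bubbles from black to white along the edges with colors in
  \<open>I\<close>, hence from white to black along those with colors in the complement.\<close>

definition bubble_succ :: "nat \<Rightarrow> nat set \<Rightarrow> 'v cgraph \<Rightarrow> 'v \<Rightarrow> 'v" where
  "bubble_succ D I G v =
     (if v \<in> black G then THE w. \<exists>i\<in>I. (i, v, w) \<in> edges G
      else if v \<in> white G then THE b. \<exists>i\<in>{1..D} - I. (i, b, v) \<in> edges G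
      else v)"

definition zero_partner :: "'v cgraph \<Rightarrow> 'v \<Rightarrow> 'v" where
  "zero_partner G v =
     (if v \<in> verts G then THE u. (0, v, u) \<in> edges G \<or> (0, u, v) \<in> edges G else v)"

text \<open>A step \<open>h \<mapsto> sigma (alpha h)\<close> of a face follows an edge of color 0 and then the edges of
  a bubble in the direction of \<open>sigma\<close>. So a face which follows a cycle of colors 0 and \<open>i \<in> I\<close>
  leaves its white vertices along color 0, and its half-edges are exactly the white vertices of
  that cycle; for \<open>i \<notin> I\<close> they are the black vertices. The cycles of colors 0 and \<open>i\<close> are
  the connected components of the subgraph with these two colors.\<close>

definition Mstar :: "nat \<Rightarrow> nat set \<Rightarrow> 'v cgraph \<Rightarrow> 'v fmap" where
  "Mstar D I G = \<lparr>half_edges = verts G,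
     sigma = bubble_succ D I G,
     alpha = zero_partner G,
     faces1 = (\<Union>i\<in>I. white ` components (restrict_colors {0, i} G)),
     faces2 = (\<Union>i\<in>{1..D} - I. black ` components (restrict_colors {0, i} G))\<rparr>"

end

theory Submission
  imports Defs
begin

text \<open>The idea is that both kinds of objects encode the same data: finite disjoint sets \<open>B\<close> and
  \<open>W\<close>, a permutation \<open>s\<close> and an involution \<open>a\<close> of \<open>B \<union> W\<close>, each exchanging \<open>B\<close> and \<open>W\<close>. In a
  gluing, \<open>a\<close> follows the edges of color 0 and \<open>s\<close> runs around the bubbles; the coincidence of
  all edges with colors in \<open>I\<close> (or in its complement) inside a cyclic bubble makes the graph
  recoverable from \<open>(B, W, s, a)\<close>. In a face-bipartite map, a half-edge is white if its face has
  color 1 and black otherwise; \<open>alpha\<close> exchanges the two classes since an edge has one face of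
  each color on its sides, and \<open>sigma\<close> does since \<open>sigma \<circ> alpha\<close> preserves faces. The
  construction \<open>Mstar\<close> is the identity on this data, and isomorphisms on both sides are the
  bijections respecting it.\<close>

section \<open>Permutation data and the graphs and maps built from them\<close>

locale color_split =
  fixes D :: nat and I :: "nat set"
  assumes I_subset: "I \<subseteq> {1..D}"
    and I_nonempty: "I \<noteq> {}"
    and I_proper: "{1..D} - I \<noteq> {}"

locale alternating_perms =
  fixes B W :: "'v set" and s a :: "'v \<Rightarrow> 'v"
  assumes finite_B: "finite B" and finite_W: "finite W"
    and disjoint: "B \<inter> W = {}"
    and s_perm: "s permutes B \<union> W" and a_perm: "a permutes B \<union> W"
    and s_B: "s ` B = W" and s_W: "s ` W = B" and a_B: "a ` B = W"
    and a_involution: "\<And>h. a (a h) = h"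

text \<open>Edges of the complementary colors are read off at their white endpoint, so that the
  single permutation \<open>s\<close> runs through both halves of each bubble.\<close>

definition perm_graph ::
    "nat \<Rightarrow> nat set \<Rightarrow> 'v set \<Rightarrow> 'v set \<Rightarrow> ('v \<Rightarrow> 'v) \<Rightarrow> ('v \<Rightarrow> 'v) \<Rightarrow> 'v cgraph" where
  "perm_graph D I B W s a = \<lparr>black = B, white = W,
     edges = {(0, b, a b) | b. b \<in> B} \<union> {(i, b, s b) | i b. i \<in> I \<and> b \<in> B} \<union>
       {(i, s w, w) | i w. i \<in> {1..D} - I \<and> w \<in> W}\<rparr>"

definition perm_map ::
    "'v set \<Rightarrow> 'v set \<Rightarrow> ('v \<Rightarrow> 'v) \<Rightarrow> ('v \<Rightarrow> 'v) \<Rightarrow> 'v fmap" where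
  "perm_map B W s a = \<lparr>half_edges = B \<union> W, sigma = s, alpha = a,
     faces1 = orbit (s \<circ> a) ` W, faces2 = orbit (s \<circ> a) ` B\<rparr>"

lemma perm_graph_simps [simp]:
  "black (perm_graph D I B W s a) = B"
  "white (perm_graph D I B W s a) = W"
  "verts (perm_graph D I B W s a) = B \<union> W"
  by (simp_all add: perm_graph_def verts_def)

lemma restrict_colors_simps [simp]:
  "black (restrict_colors S G) = black G"
  "white (restrict_colors S G) = white G"
  "verts (restrict_colors S G) = verts G"
  "(c, b, w) \<in> edges (restrict_colors S G) \<longleftrightarrow> (c, b, w) \<in> edges G \<and> c \<in> S"
  by (simp_all add: restrict_colors_def verts_def)

lemma induced_subgraph_simps [simp]:
  "black (induced_subgraph G S) = black G \<inter> S"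
  "white (induced_subgraph G S) = white G \<inter> S"
  "(c, b, w) \<in> edges (induced_subgraph G S) \<longleftrightarrow> (c, b, w) \<in> edges G \<and> b \<in> S \<and> w \<in> S"
  by (simp_all add: induced_subgraph_def)

text \<open>Some power of a permutation of a finite set inverts it, so backward steps lead nowhere
  new and undirected reachability is the forward orbit. With \<open>s\<close> as the permutation
  this turns bubbles into cycles of \<open>s\<close>.\<close>

lemma rtrancl_perm:
  assumes p: "p permutes S" and fin: "finite S" and v: "v \<in> S"
  shows "{u. (v, u) \<in> {(x, y). x \<in> S \<and> y = p x \<or> y \<in> S \<and> x = p y}\<^sup>*} = orbit p v"
    (is "{u. (v, u) \<in> ?R\<^sup>*} = _")
proof
  have perm: "permutation p"
    using p fin by (auto simp: permutation_permutes)
  show "{u. (v, u) \<in> ?R\<^sup>*} \<subseteq> orbit p v"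
  proof clarify
    fix u assume "(v, u) \<in> ?R\<^sup>*"
    then show "u \<in> orbit p v"
    proof induction
      case base
      then show ?case by (rule permutation_self_in_orbit[OF perm])
    next
      case (step y z)
      from step.hyps consider "z = p y" | "y = p z" by auto
      then show ?case
      proof cases
        case 1
        then show ?thesis using step.IH by (auto intro: orbit.step)
      next
        case 2
        have "z \<in> orbit p y"
          unfolding 2 permutation_orbit_step[OF perm] by (rule permutation_self_in_orbit[OF perm])
        then show ?thesis using step.IH by (rule orbit_trans)
      qed
    qed
  qed
  show "orbit p v \<subseteq> {u. (v, u) \<in> ?R\<^sup>*}"
  proof
    fix u assume "u \<in> orbit p v"
    then have "u \<in> S \<and> (v, u) \<in> ?R\<^sup>*"
    proof induction
      case base
      then show ?case using v p by (auto simp: permutes_in_image)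
    next
      case (step y)
      then have "(y, p y) \<in> ?R" by auto
      then show ?case using step p by (auto simp: permutes_in_image intro: rtrancl_into_rtrancl)
    qed
    then show "u \<in> {u. (v, u) \<in> ?R\<^sup>*}" by simp
  qed
qed

section \<open>Cycles of alternating permutations\<close>

context alternating_perms
begin

lemma exchange [simp]:
  "h \<in> B \<Longrightarrow> s h \<in> W" "h \<in> W \<Longrightarrow> s h \<in> B" "h \<in> B \<Longrightarrow> a h \<in> W"
  using s_B s_W a_B by auto

lemma a_W: "a ` W = B"
proof -
  have "a ` W = a ` a ` B" by (simp add: a_B)
  then show ?thesis by (simp add: image_image a_involution)
qed

lemma a_exchange_W [simp]: "h \<in> W \<Longrightarrow> a h \<in> B"
  using a_W by auto

lemma not_both: "h \<in> B \<Longrightarrow> h \<in> W \<Longrightarrow> False"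
  using disjoint by auto

lemma s_inj [simp]: "s x = s y \<longleftrightarrow> x = y"
  using permutes_inj[OF s_perm] by (auto simp: inj_eq)

text \<open>The two classes enter symmetrically; this transfers facts proved for \<open>W\<close> to
  \<open>B\<close>.\<close>

lemma swap: "alternating_perms W B s a"
  using finite_B finite_W disjoint s_perm a_perm s_B s_W a_W a_involution
  by unfold_locales (auto simp: Un_commute)

lemma finite_BW: "finite (B \<union> W)"
  using finite_B finite_W by simp

lemma face_perm: "s \<circ> a permutes B \<union> W"
  by (rule permutes_compose[OF a_perm s_perm])

lemma permutation_face: "permutation (s \<circ> a)"
  using face_perm finite_BW by (auto simp: permutation_permutes)

lemma permutation_s: "permutation s"
  using s_perm finite_BW by (auto simp: permutation_permutes)

lemma face_subset_W:
  assumes "w \<in> W" shows "orbit (s \<circ> a) w \<subseteq> W"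
proof
  fix u assume "u \<in> orbit (s \<circ> a) w"
  then show "u \<in> W" by induction (use assms in auto)
qed

text \<open>The relation joins a black vertex to its images under \<open>a\<close> and
  \<open>s\<close>, as the colors 0 and \<open>i \<in> I\<close> do. Two steps along a cycle of
  these colors, \<open>a\<close> from white to black and \<open>s\<close> back to white, make one
  step of \<open>s \<circ> a\<close>.\<close>

lemma component_inter_W:
  assumes w: "w \<in> W"
  shows "W \<inter> {u. (w, u) \<in> {(x, y). x \<in> B \<and> (y = a x \<or> y = s x) \<or> y \<in> B \<and> (x = a y \<or> x = s y)}\<^sup>*} =
    orbit (s \<circ> a) w" (is "_ \<inter> {u. (w, u) \<in> ?R\<^sup>*} = ?O")
proof
  \<comment> \<open>Invariant of the walk: a white vertex reached lies on the face itself, a black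
    one is the \<open>a\<close>-partner of a vertex of the face.\<close>
  have "u \<in> ?O \<or> a u \<in> ?O" if "(w, u) \<in> ?R\<^sup>*" for u
    using that
  proof induction
    case base
    then show ?case using permutation_self_in_orbit[OF permutation_face] by blast
  next
    case (step y z)
    have preimage: "x \<in> ?O" if "(s \<circ> a) x \<in> ?O" for x
    proof -
      have "x \<in> orbit (s \<circ> a) ((s \<circ> a) x)"
        unfolding permutation_orbit_step[OF permutation_face]
        by (rule permutation_self_in_orbit[OF permutation_face])
      then show ?thesis using that by (rule orbit_trans)
    qed
    from step.hyps(2) consider "z = a y" | "y = a z" | "y \<in> B" "z = s y" | "z \<in> B" "y = s z"
      by auto
    then show ?case
    proof cases
      case 3
      then have "a y \<in> ?O" using step.IH face_subset_W[OF w] not_both by blast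
      then have "(s \<circ> a) (a y) \<in> ?O" by (rule orbit.step)
      then have "s y \<in> ?O" by (simp only: o_apply a_involution)
      then show ?thesis unfolding 3(2) by blast
    next
      \<comment> \<open>Here the edge is traversed against \<open>s\<close>, so the face is followed
        backwards: \<open>a z\<close> precedes \<open>y\<close> on it.\<close>
      case 4
      then have "y \<in> ?O" using step.IH face_subset_W[OF w] not_both
        by (metis exchange(1) a_exchange_W subsetD)
      then have "(s \<circ> a) (a z) \<in> ?O" using 4 by (simp add: a_involution)
      then show ?thesis using preimage by blast
    qed (use step.IH in \<open>auto simp: a_involution\<close>)
  qed
  moreover have "a u \<notin> ?O" if "u \<in> W" for u
    using that a_exchange_W[of u] face_subset_W[OF w] not_both by blast
  ultimately show "W \<inter> {u. (w, u) \<in> ?R\<^sup>*} \<subseteq> ?O"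
    by blast
  show "?O \<subseteq> W \<inter> {u. (w, u) \<in> ?R\<^sup>*}"
  proof
    fix u assume u: "u \<in> ?O"
    have face_step: "(y, (s \<circ> a) y) \<in> ?R\<^sup>*" if "y \<in> W" for y
    proof -
      have "(y, a y) \<in> ?R" "(a y, (s \<circ> a) y) \<in> ?R"
        using that by (auto simp: a_involution)
      then show ?thesis by (meson r_into_rtrancl rtrancl_trans)
    qed
    from u have "(w, u) \<in> ?R\<^sup>*"
    proof induction
      case base
      then show ?case by (rule face_step[OF w])
    next
      case (step y)
      then have "y \<in> W" using face_subset_W[OF w] by auto
      then show ?case using step.IH face_step by (meson rtrancl_trans)
    qed
    then show "u \<in> W \<inter> {u. (w, u) \<in> ?R\<^sup>*}" using u face_subset_W[OF w] by auto
  qed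
qed

text \<open>A component may be given by a starting vertex of either color. A black one shares its
  component with its partner under \<open>a\<close>, so black vertices yield the same faces as white
  ones.\<close>

lemma components_inter_W:
  assumes r: "r = {(x, y). x \<in> B \<and> (y = a x \<or> y = s x) \<or> y \<in> B \<and> (x = a y \<or> x = s y)}"
  shows "(\<lambda>v. W \<inter> {u \<in> B \<union> W. (v, u) \<in> r\<^sup>*}) ` (B \<union> W) = orbit (s \<circ> a) ` W"
proof -
  have W: "W \<inter> {u \<in> B \<union> W. (v, u) \<in> r\<^sup>*} = orbit (s \<circ> a) v" if "v \<in> W" for v
    using component_inter_W[OF that] unfolding r by auto
  have B: "W \<inter> {u \<in> B \<union> W. (v, u) \<in> r\<^sup>*} = orbit (s \<circ> a) (a v)" if "v \<in> B" for v
  proof -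
    have "(v, a v) \<in> r" "(a v, v) \<in> r" using that by (auto simp: r)
    then have "(v, u) \<in> r\<^sup>* \<longleftrightarrow> (a v, u) \<in> r\<^sup>*" for u
      by (meson converse_rtrancl_into_rtrancl)
    then show ?thesis using W[of "a v"] that by simp
  qed
  let ?C = "\<lambda>v. W \<inter> {u \<in> B \<union> W. (v, u) \<in> r\<^sup>*}"
  have "?C ` W = orbit (s \<circ> a) ` W"
    using refl W by (rule image_cong)
  moreover have "?C ` B = (\<lambda>v. orbit (s \<circ> a) (a v)) ` B"
    using refl B by (rule image_cong)
  then have "?C ` B = orbit (s \<circ> a) ` W"
    unfolding a_B[symmetric] image_image .
  ultimately show ?thesis
    unfolding image_Un by (simp only: Un_absorb)
qed

text \<open>The color classes can be recovered from the colored faces; this is how isomorphisms of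
  maps are seen to respect black and white.\<close>

lemma Union_faces_W: "\<Union> (orbit (s \<circ> a) ` W) = W"
  using face_subset_W permutation_self_in_orbit[OF permutation_face] by blast

lemma funpow_s:
  assumes "v \<in> B"
  shows "(s ^^ n) v \<in> (if even n then B else W)"
  using assms by (induction n) (auto split: if_splits)

end

section \<open>The gluing built from the data, and its map\<close>

locale alternating_gluing = color_split D I + alternating_perms B W s a
  for D I B W s a
begin

abbreviation "\<G> \<equiv> perm_graph D I B W s a"

lemma edges_perm_graph:
  "(c, b, w) \<in> edges \<G> \<longleftrightarrow>
     c = 0 \<and> b \<in> B \<and> w = a b \<or> c \<in> I \<and> b \<in> B \<and> w = s b \<or>
     c \<in> {1..D} - I \<and> w \<in> W \<and> b = s w"
  by (auto simp: perm_graph_def)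

lemma zero_notin_I: "0 \<notin> I"
  using I_subset by auto

lemma ex1_s_B: "b \<in> B \<Longrightarrow> \<exists>!w. w \<in> W \<and> b = s w"
  using s_W by (auto)

lemma ex1_s_W: "w \<in> W \<Longrightarrow> \<exists>!b. b \<in> B \<and> w = s b"
  using s_B by (auto)

lemma regular: "regular_cgraph D \<G>"
proof -
  have "\<exists>!w. (c, b, w) \<in> edges \<G>" if c: "c \<in> {0..D}" "b \<in> B" for c b
  proof -
    consider "c = 0" | "c \<in> I" | "c \<in> {1..D} - I" using c by fastforce
    then show ?thesis
      by cases (use that ex1_s_B[of b] zero_notin_I in \<open>auto simp: edges_perm_graph\<close>)
  qed
  moreover have "\<exists>!b. (c, b, w) \<in> edges \<G>" if c: "c \<in> {0..D}" "w \<in> W" for c w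
  proof -
    have w: "w = a b \<longleftrightarrow> b = a w" for b by (metis a_involution)
    consider "c = 0" | "c \<in> I" | "c \<in> {1..D} - I" using c by fastforce
    then show ?thesis
      by cases (use that ex1_s_W[of w] zero_notin_I w in \<open>auto simp: edges_perm_graph\<close>)
  qed
  moreover have "edges \<G> \<subseteq> {0..D} \<times> B \<times> W"
    using I_subset by (auto simp: edges_perm_graph)
  ultimately show ?thesis
    using finite_B finite_W disjoint by (auto simp: regular_cgraph_def)
qed

text \<open>Both classes of colors are nonempty, so every step of \<open>s\<close> is realized by an
  edge: from a black vertex by a color in \<open>I\<close>, from a white one by a color outside
  \<open>I\<close>.\<close>

lemma adj_bubbles:
  "adj (restrict_colors {1..D} \<G>) =
     {(x, y). x \<in> B \<union> W \<and> y = s x \<or> y \<in> B \<union> W \<and> x = s y}"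
proof -
  obtain i j where "i \<in> I" "i \<in> {1..D}" "j \<in> {1..D} - I"
    using I_nonempty I_proper I_subset by blast
  then have "(\<exists>c. (c, x, y) \<in> edges \<G> \<and> c \<in> {1..D}) \<longleftrightarrow> 
     x \<in> B \<and> y = s x \<or> y \<in> W \<and> x = s y" for x y
    using I_subset zero_notin_I unfolding edges_perm_graph by auto
  then show ?thesis
    unfolding adj_def restrict_colors_simps ex_disj_distrib by auto
qed

text \<open>The required enumeration lists the cycle of \<open>s\<close> from the black vertex
  \<open>v\<close>. As \<open>s\<close> exchanges the classes, the positions alternate in color and
  the length is even.\<close>

lemma bubble_cyclic:
  assumes v: "v \<in> B"
  shows "\<exists>p. cyclic_bubble D I p (induced_subgraph (restrict_colors {1..D} \<G>) (orbit s v))"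
proof -
  \<comment> \<open>The cycle length: the least positive \<open>n\<close> with
    \<open>(s ^^ n) v = v\<close>.\<close>
  define N where "N = funpow_dist1 s v v"
  define x where "x n = (s ^^ n) v" for n
  have self: "v \<in> orbit s v"
    by (rule permutation_self_in_orbit[OF permutation_s])
  have xN: "(s ^^ N) v = v"
    unfolding N_def by (rule funpow_dist1_prop[OF self])
  have xmod: "x (n mod N) = x n" for n
    unfolding x_def by (rule funpow_mod_eq[OF xN])
  have orb: "orbit s v = x ` {..<N}"
    unfolding N_def x_def orbit_conv_funpow_dist1[OF self] by (simp add: atLeast0LessThan)
  have inj: "inj_on x {..<N}"
    using inj_on_funpow_dist1[OF self] unfolding N_def x_def by (simp add: atLeast0LessThan)
  have xB: "x n \<in> B \<longleftrightarrow> even n" and xW: "x n \<in> W \<longleftrightarrow> odd n" for n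
    using funpow_s[OF v, of n] not_both unfolding x_def by (auto split: if_splits)
  have "even N" using xB[of N] xN v by (simp add: x_def)
  then obtain p where p: "N = 2 * p" by auto
  have "p \<ge> 1" using p by (cases p) (auto simp: N_def)
  have xSuc: "s (x n) = x (Suc n)" for n by (simp add: x_def)
  have BO: "B \<inter> orbit s v = {x (2 * j) | j. j < p}"
    unfolding orb p using xB by (fastforce elim!: evenE)
  have WO: "W \<inter> orbit s v = {x (2 * j + 1) | j. j < p}"
    unfolding orb p using xW by (fastforce elim!: oddE)
  have edge: "(c, b, w) \<in> edges (induced_subgraph (restrict_colors {1..D} \<G>) (orbit s v)) \<longleftrightarrow>
      c \<in> I \<and> b \<in> B \<inter> orbit s v \<and> w = s b \<or>
      c \<in> {1..D} - I \<and> w \<in> W \<inter> orbit s v \<and> b = s w" for c b w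
    using I_subset by (auto simp: edges_perm_graph orbit.step)
  have "edges (induced_subgraph (restrict_colors {1..D} \<G>) (orbit s v)) =
      {(c, x (2 * j), x (2 * j + 1)) | c j. c \<in> I \<and> j < p} \<union>
      {(c, x ((2 * j + 2) mod (2 * p)), x (2 * j + 1)) | c j. c \<in> {1..D} - I \<and> j < p}"
    \<comment> \<open>The remainder modulo \<open>2 * p\<close> matters only for the edges closing
      the cycle. Periodicity of \<open>x\<close> removes it, and \<open>s (x n) = x (Suc n)\<close>
      then identifies the edges.\<close>
    unfolding xmod[unfolded p] set_eq_iff split_paired_All edge BO WO
    by (auto simp: xSuc; blast)
  then show ?thesis
    unfolding cyclic_bubble_def using BO WO inj \<open>p \<ge> 1\<close> by (auto simp: p)
qed

lemma components_cyclic: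
  assumes "C \<in> components (restrict_colors {1..D} \<G>)"
  shows "\<exists>p. cyclic_bubble D I p C"
proof -
  obtain v where v: "v \<in> B \<union> W"
    and C: "C = induced_subgraph (restrict_colors {1..D} \<G>)
      {u \<in> B \<union> W. (v, u) \<in> (adj (restrict_colors {1..D} \<G>))\<^sup>*}"
    using assms by (auto simp: components_def)
  have "{u \<in> B \<union> W. (v, u) \<in> (adj (restrict_colors {1..D} \<G>))\<^sup>*} = orbit s v"
    using rtrancl_perm[OF s_perm finite_BW v] permutes_orbit_subset[OF s_perm v]
    unfolding adj_bubbles by auto
  \<comment> \<open>The component may be generated by a white vertex; its successor is black and
    lies on the same cycle.\<close>
  moreover have "orbit s v = orbit s (s v)"
    by (simp add: permutation_orbit_step[OF permutation_s])
  ultimately show ?thesis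
    using bubble_cyclic[of v] bubble_cyclic[of "s v"] v C by auto
qed

text \<open>All colors of \<open>I\<close> join \<open>b\<close> to \<open>s b\<close>, so each of
  them gives the same family of faces.\<close>

lemma components_zero_I:
  assumes i: "i \<in> I"
  shows "white ` components (restrict_colors {0, i} \<G>) = orbit (s \<circ> a) ` W"
proof -
  have "(\<exists>c. (c, b, w) \<in> edges \<G> \<and> c \<in> {0, i}) \<longleftrightarrow> b \<in> B \<and> (w = a b \<or> w = s b)" for b w
    using i zero_notin_I unfolding edges_perm_graph by auto
  then have "adj (restrict_colors {0, i} \<G>) =
      {(x, y). x \<in> B \<and> (y = a x \<or> y = s x) \<or> y \<in> B \<and> (x = a y \<or> x = s y)}"
    unfolding adj_def restrict_colors_simps ex_disj_distrib by auto
  from components_inter_W[OF this] show ?thesis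
    by (simp add: components_def image_image)
qed

text \<open>Edges of these colors join a white \<open>w\<close> to \<open>s w\<close>: this is the
  situation of \<open>components_zero_I\<close> with the two classes exchanged.\<close>

lemma components_zero_compl:
  assumes i: "i \<in> {1..D} - I"
  shows "black ` components (restrict_colors {0, i} \<G>) = orbit (s \<circ> a) ` B"
proof -
  have "w = a b \<and> b \<in> B \<longleftrightarrow> w \<in> W \<and> b = a w" for b w
    using a_involution exchange(3) a_exchange_W by metis
  then have "(\<exists>c. (c, b, w) \<in> edges \<G> \<and> c \<in> {0, i}) \<longleftrightarrow> w \<in> W \<and> (b = a w \<or> b = s w)" for b w
    using i zero_notin_I unfolding edges_perm_graph by auto
  then have "adj (restrict_colors {0, i} \<G>) =
      {(x, y). x \<in> W \<and> (y = a x \<or> y = s x) \<or> y \<in> W \<and> (x = a y \<or> x = s y)}"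
    unfolding adj_def restrict_colors_simps ex_disj_distrib by auto
  from alternating_perms.components_inter_W[OF swap this] show ?thesis
    by (simp add: components_def image_image Un_commute)
qed

lemma bubble_succ_perm_graph: "bubble_succ D I \<G> = s"
proof
  fix v
  obtain i j where i: "i \<in> I" "i \<in> {1..D}" and j: "j \<in> {1..D} - I"
    using I_nonempty I_proper I_subset by blast
  consider "v \<in> B" | "v \<in> W" "v \<notin> B" | "v \<notin> B \<union> W" by auto
  then show "bubble_succ D I \<G> v = s v"
  proof cases
    case 1
    then have "(\<exists>i\<in>I. (i, v, w) \<in> edges \<G>) \<longleftrightarrow> w = s v" for w
      using i zero_notin_I by (auto simp: edges_perm_graph)
    then show ?thesis using 1 by (simp add: bubble_succ_def)
  next
    case 2
    then have "(\<exists>i\<in>{1..D} - I. (i, b, v) \<in> edges \<G>) \<longleftrightarrow> b = s v" for b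
      using j by (auto simp: edges_perm_graph)
    then show ?thesis using 2 by (simp add: bubble_succ_def)
  next
    \<comment> \<open>Outside the vertex set \<open>bubble_succ\<close> returns its argument, and so
      does \<open>s\<close>, being a permutation of \<open>B \<union> W\<close>.\<close>
    case 3
    then show ?thesis using s_perm by (simp add: bubble_succ_def permutes_not_in)
  qed
qed

lemma zero_partner_perm_graph: "zero_partner \<G> = a"
proof
  fix v
  show "zero_partner \<G> v = a v"
  proof (cases "v \<in> B \<union> W")
    case True
    then have "(0, v, u) \<in> edges \<G> \<or> (0, u, v) \<in> edges \<G> \<longleftrightarrow> u = a v" for u
      using zero_notin_I a_involution a_exchange_W not_both unfolding edges_perm_graph by fastforce
    then show ?thesis using True by (simp add: zero_partner_def)
  next
    case False
    then show ?thesis using a_perm by (simp add: zero_partner_def permutes_not_in)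
  qed
qed

text \<open>The unions over colors that define the faces each collapse to one constant family, since
  \<open>I\<close> and its complement are nonempty.\<close>

lemma Mstar_perm_graph: "Mstar D I \<G> = perm_map B W s a"
  using I_nonempty I_proper
  by (simp add: Mstar_def perm_map_def bubble_succ_perm_graph zero_partner_perm_graph
      components_zero_I components_zero_compl)

text \<open>On vertices, the steps allowed in the map (\<open>s\<close>, its inverse and
  \<open>a\<close>) are the edges of the graph taken in either direction. Nonemptiness is part of
  \<open>connected_cgraph\<close> but not of \<open>connected_map\<close>.\<close>

lemma connected_iff:
  "connected_cgraph \<G> \<longleftrightarrow> B \<union> W \<noteq> {} \<and> connected_map (perm_map B W s a)"
proof -
  let ?R = "{(x, y). y = s x \<or> x = s y \<or> y = a x}"
  obtain i j where "i \<in> I" "j \<in> {1..D} - I"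
    using I_nonempty I_proper by blast
  then have "(\<exists>c. (c, x, y) \<in> edges \<G>) \<longleftrightarrow>
      x \<in> B \<and> y = a x \<or> x \<in> B \<and> y = s x \<or> y \<in> W \<and> x = s y" for x y
    unfolding edges_perm_graph by auto
  then have adj: "(x, y) \<in> adj \<G> \<longleftrightarrow> x \<in> B \<and> y = a x \<or> x \<in> B \<and> y = s x \<or> y \<in> W \<and> x = s y \<or>
      y \<in> B \<and> x = a y \<or> y \<in> B \<and> x = s y \<or> x \<in> W \<and> y = s x" for x y
    unfolding adj_def ex_disj_distrib by blast
  have "(x, y) \<in> (adj \<G>)\<^sup>* \<longleftrightarrow> (x, y) \<in> ?R\<^sup>*" if x: "x \<in> B \<union> W" for x y
  proof
    have "adj \<G> \<subseteq> ?R" by (auto simp: adj a_involution)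
    then show "(x, y) \<in> (adj \<G>)\<^sup>* \<Longrightarrow> (x, y) \<in> ?R\<^sup>*" using rtrancl_mono by blast
    assume "(x, y) \<in> ?R\<^sup>*"
    then have "y \<in> B \<union> W \<and> (x, y) \<in> (adj \<G>)\<^sup>*"
    proof induction
      case (step y z)
      then have "z \<in> B \<union> W"
        using permutes_in_image[OF s_perm] permutes_in_image[OF a_perm] by auto
      moreover have "(y, z) \<in> adj \<G>"
      proof -
        from step.hyps consider "z = s y" | "y = s z" | "z = a y" by auto
        then show ?thesis
          by cases (use step.IH \<open>z \<in> B \<union> W\<close> in \<open>auto simp: adj a_involution\<close>)
      qed
      ultimately show ?case using step.IH by (meson rtrancl.rtrancl_into_rtrancl)
    qed (use x in simp)
    then show "(x, y) \<in> (adj \<G>)\<^sup>*" by simp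
  qed
  then show ?thesis
    by (auto simp: connected_cgraph_def connected_map_def perm_map_def)
qed

text \<open>Regularity and the bubble condition hold for any such data, which leaves
  connectedness.\<close>

lemma perm_graph_in_gluings_iff:
  "\<G> \<in> gluings D I \<longleftrightarrow> B \<union> W \<noteq> {} \<and> connected_map (perm_map B W s a)"
  using regular components_cyclic by (auto simp: gluings_def connected_iff)

text \<open>Since \<open>a\<close> exchanges disjoint classes, it has no fixed point among the
  half-edges. Since \<open>s \<circ> a\<close> preserves each class, a face lies within one of them
  and cannot receive both colors.\<close>

lemma perm_map_in_face_bipartite_maps:
  assumes "\<G> \<in> gluings D I"
  shows "perm_map B W s a \<in> face_bipartite_maps"
proof -
  let ?M = "perm_map B W s a"
  have "a h \<noteq> h" if "h \<in> B \<union> W" for h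
    using that not_both exchange(3) a_exchange_W by (metis UnE)
  then have "comb_map ?M"
    using finite_BW s_perm a_perm a_involution by (auto simp: comb_map_def perm_map_def)
  moreover have "face_bipartite ?M"
  proof -
    have "orbit (s \<circ> a) w \<noteq> orbit (s \<circ> a) b" if "w \<in> W" "b \<in> B" for w b
      using that face_subset_W[of w] alternating_perms.face_subset_W[OF swap, of b]
        permutation_self_in_orbit[OF permutation_face, of w] not_both by blast
    then show ?thesis
      unfolding face_bipartite_def by (auto simp: perm_map_def face_def)
  qed
  ultimately show ?thesis
    using assms unfolding perm_graph_in_gluings_iff
    by (auto simp: face_bipartite_maps_def perm_map_def)
qed

lemma Union_faces_B: "\<Union> (orbit (s \<circ> a) ` B) = B"
  by (rule alternating_perms.Union_faces_W[OF swap])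

end

section \<open>Isomorphisms of gluings and of maps\<close>

text \<open>Color 0 and one color from each class determine \<open>a\<close> and \<open>s\<close>,
  so preserving edges forces \<open>f\<close> to commute with both. Faces are orbits and are carried
  along, with their colors because \<open>f\<close> respects the two classes.\<close>

lemma cgraph_iso_imp_fmap_iso:
  assumes "alternating_gluing D I B W s a" and "alternating_gluing D I B' W' s' a'"
    and iso: "cgraph_iso (perm_graph D I B W s a) (perm_graph D I B' W' s' a') f"
  shows "fmap_iso (perm_map B W s a) (perm_map B' W' s' a') f"
proof -
  interpret G: alternating_gluing D I B W s a by fact
  interpret H: alternating_gluing D I B' W' s' a' by fact
  have fB: "f ` B = B'" and fW: "f ` W = W'" and bij: "bij_betw f (B \<union> W) (B' \<union> W')"
    using iso by (simp_all add: cgraph_iso_def)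
  have edge: "(c, f b, f w) \<in> edges H.\<G>" if "(c, b, w) \<in> edges G.\<G>" for c b w
  proof -
    have "(\<lambda>(c, b, w). (c, f b, f w)) (c, b, w) \<in> edges H.\<G>"
      using iso that unfolding cgraph_iso_def by blast
    then show ?thesis by simp
  qed
  obtain i j where i: "i \<in> I" and j: "j \<in> {1..D} - I"
    using G.I_nonempty G.I_proper by blast
  have aB: "f (a b) = a' (f b)" if "b \<in> B" for b
    using edge[of 0 b "a b"] that H.zero_notin_I by (auto simp: G.edges_perm_graph H.edges_perm_graph)
  have aW: "f (a w) = a' (f w)" if "w \<in> W" for w
    using aB[of "a w"] that by (simp add: G.a_involution H.a_involution)
  have sB: "f (s b) = s' (f b)" if "b \<in> B" for b
    using edge[of i b "s b"] that i H.zero_notin_I by (auto simp: G.edges_perm_graph H.edges_perm_graph)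
  have sW: "f (s w) = s' (f w)" if "w \<in> W" for w
    using edge[of j "s w" w] that j by (auto simp: G.edges_perm_graph H.edges_perm_graph)
  have "f ` orbit (s \<circ> a) h = orbit (s' \<circ> a') (f h)" if "h \<in> B \<union> W" for h
  proof (rule orbit_inverse)
    show "h \<in> orbit (s \<circ> a) h" by (rule permutation_self_in_orbit[OF G.permutation_face])
    show "(s' \<circ> a') (f x) = f ((s \<circ> a) x)" if "x \<in> orbit (s \<circ> a) h" for x
      using that permutes_orbit_subset[OF G.face_perm \<open>h \<in> B \<union> W\<close>]
      by (auto simp: aB aW sB sW)
  qed
  then have "(`) f ` orbit (s \<circ> a) ` S = orbit (s' \<circ> a') ` f ` S" if "S \<subseteq> B \<union> W" for S
    using that by (auto simp: image_image intro!: image_cong)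
  from this[of B] this[of W] show ?thesis
    using bij by (auto simp: fmap_iso_def perm_map_def fB fW aB aW sB sW)
qed

text \<open>An isomorphism of maps does not mention vertex colors, but it preserves the two families
  of faces, whose unions are the classes \<open>W\<close> and \<open>B\<close>. Commuting with
  \<open>a\<close> and \<open>s\<close> then gives the edges.\<close>

lemma fmap_iso_imp_cgraph_iso:
  assumes "alternating_gluing D I B W s a" and "alternating_gluing D I B' W' s' a'"
    and iso: "fmap_iso (perm_map B W s a) (perm_map B' W' s' a') f"
  shows "cgraph_iso (perm_graph D I B W s a) (perm_graph D I B' W' s' a') f"
proof -
  interpret G: alternating_gluing D I B W s a by fact
  interpret H: alternating_gluing D I B' W' s' a' by fact
  have bij: "bij_betw f (B \<union> W) (B' \<union> W')"
    and s: "\<And>h. h \<in> B \<union> W \<Longrightarrow> f (s h) = s' (f h)"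
    and a: "\<And>h. h \<in> B \<union> W \<Longrightarrow> f (a h) = a' (f h)"
    and faces: "(`) f ` orbit (s \<circ> a) ` W = orbit (s' \<circ> a') ` W'"
      "(`) f ` orbit (s \<circ> a) ` B = orbit (s' \<circ> a') ` B'"
    using iso by (simp_all add: fmap_iso_def perm_map_def)
  have "f ` W = W'"
    by (metis faces(1) G.Union_faces_W H.Union_faces_W image_Union)
  moreover have "f ` B = B'"
    by (metis faces(2) G.Union_faces_B H.Union_faces_B image_Union)
  moreover have "(\<lambda>(c, b, w). (c, f b, f w)) ` edges G.\<G> = edges H.\<G>"
  proof -
    have inj: "f x = f y \<longleftrightarrow> x = y" if "x \<in> B \<union> W" "y \<in> B \<union> W" for x y
      using bij that by (auto simp: bij_betw_def inj_on_eq_iff)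
    have edge: "(c, f b, f w) \<in> edges H.\<G> \<longleftrightarrow> (c, b, w) \<in> edges G.\<G>" if "b \<in> B" "w \<in> W" for c b w
    proof -
      have "f b \<in> B'" "f w \<in> W'"
        using that \<open>f ` B = B'\<close> \<open>f ` W = W'\<close> by auto
      moreover have "f w = a' (f b) \<longleftrightarrow> w = a b" "f w = s' (f b) \<longleftrightarrow> w = s b"
        "f b = s' (f w) \<longleftrightarrow> b = s w"
        using that by (simp_all add: inj flip: a s)
      ultimately show ?thesis
        using that by (simp add: G.edges_perm_graph H.edges_perm_graph)
    qed
    have GE: "b \<in> B \<and> w \<in> W" if "(c, b, w) \<in> edges G.\<G>" for c b w
      using that by (auto simp: G.edges_perm_graph)
    have HE: "b \<in> B' \<and> w \<in> W'" if "(c, b, w) \<in> edges H.\<G>" for c b w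
      using that by (auto simp: H.edges_perm_graph)
    show ?thesis
    proof
      show "(\<lambda>(c, b, w). (c, f b, f w)) ` edges G.\<G> \<subseteq> edges H.\<G>"
        using edge GE by auto
      show "edges H.\<G> \<subseteq> (\<lambda>(c, b, w). (c, f b, f w)) ` edges G.\<G>"
      proof clarify
        fix c b' w' assume e: "(c, b', w') \<in> edges H.\<G>"
        obtain b w where "b \<in> B" "w \<in> W" "b' = f b" "w' = f w"
          using HE[OF e] \<open>f ` B = B'\<close> \<open>f ` W = W'\<close> by blast
        then show "(c, b', w') \<in> (\<lambda>(c, b, w). (c, f b, f w)) ` edges G.\<G>"
          using e edge[of b w c] by (auto intro!: rev_image_eqI[of "(c, b, w)"])
      qed
    qed
  qed
  ultimately show ?thesis
    using bij by (simp add: cgraph_iso_def)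
qed

section \<open>Recovering the data from a gluing\<close>

text \<open>The enumeration of a bubble is injective, so a black vertex fixes its position
  \<open>j\<close>, and with it the white neighbor common to all colors of \<open>I\<close>.\<close>

lemma cyclic_bubble_I_edges:
  assumes "cyclic_bubble D I p C" "(i, b, w) \<in> edges C" "(i', b, w') \<in> edges C" "i \<in> I" "i' \<in> I"
  shows "w = w'"
proof -
  obtain v where inj: "inj_on v {..<2 * p}"
    and E: "edges C =
      {(c, v (2 * j), v (2 * j + 1)) | c j. c \<in> I \<and> j < p} \<union>
      {(c, v ((2 * j + 2) mod (2 * p)), v (2 * j + 1)) | c j. c \<in> {1..D} - I \<and> j < p}"
    using assms(1) unfolding cyclic_bubble_def by (elim conjE exE) (rule that, assumption+)
  obtain j where j: "j < p" "b = v (2 * j)" "w = v (2 * j + 1)"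
    using assms(2,4) unfolding E by auto
  obtain j' where j': "j' < p" "b = v (2 * j')" "w' = v (2 * j' + 1)"
    using assms(3,5) unfolding E by auto
  have "2 * j = 2 * j'"
    using j j' by (intro inj_onD[OF inj]) auto
  then show ?thesis using j j' by simp
qed

lemma cyclic_bubble_compl_edges:
  assumes "cyclic_bubble D I p C" "(i, b, w) \<in> edges C" "(i', b', w) \<in> edges C"
    "i \<notin> I" "i' \<notin> I"
  shows "b = b'"
proof -
  obtain v where inj: "inj_on v {..<2 * p}"
    and E: "edges C =
      {(c, v (2 * j), v (2 * j + 1)) | c j. c \<in> I \<and> j < p} \<union>
      {(c, v ((2 * j + 2) mod (2 * p)), v (2 * j + 1)) | c j. c \<in> {1..D} - I \<and> j < p}"
    using assms(1) unfolding cyclic_bubble_def by (elim conjE exE) (rule that, assumption+)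
  obtain j where j: "j < p" "b = v ((2 * j + 2) mod (2 * p))" "w = v (2 * j + 1)"
    using assms(2,4) unfolding E by auto
  obtain j' where j': "j' < p" "b' = v ((2 * j' + 2) mod (2 * p))" "w = v (2 * j' + 1)"
    using assms(3,5) unfolding E by auto
  have "2 * j + 1 = 2 * j' + 1"
    using j j' by (intro inj_onD[OF inj]) auto
  then show ?thesis using j j' by simp
qed

context color_split
begin

text \<open>Edges parallel within a bubble make \<open>bubble_succ\<close> independent of the color
  used, and regularity makes it and \<open>zero_partner\<close> exchange the two classes. Every edge
  of \<open>G\<close> then belongs to one of the three families in
  \<open>perm_graph\<close>.\<close>

lemma gluing_alternating:
  assumes G: "G \<in> gluings D I"
  defines "s \<equiv> bubble_succ D I G" and "a \<equiv> zero_partner G"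
  shows "alternating_gluing D I (black G) (white G) s a"
    and "perm_graph D I (black G) (white G) s a = G"
proof -
  have reg: "regular_cgraph D G" using G by (simp add: gluings_def)
  have fin: "finite (black G)" "finite (white G)" and dis: "black G \<inter> white G = {}"
    and sub: "edges G \<subseteq> {0..D} \<times> black G \<times> white G"
    using reg by (simp_all add: regular_cgraph_def)
  have exB: "\<exists>w. (c, b, w) \<in> edges G"
    and unB: "\<And>w w'. (c, b, w) \<in> edges G \<Longrightarrow> (c, b, w') \<in> edges G \<Longrightarrow> w = w'"
    if "c \<in> {0..D}" "b \<in> black G" for c b
    using reg that unfolding regular_cgraph_def by blast+
  have exW: "\<exists>b. (c, b, w) \<in> edges G"
    and unW: "\<And>b b'. (c, b, w) \<in> edges G \<Longrightarrow> (c, b', w) \<in> edges G \<Longrightarrow> b = b'"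
    if "c \<in> {0..D}" "w \<in> white G" for c w
    using reg that unfolding regular_cgraph_def by blast+
  have endp: "c \<in> {0..D}" "b \<in> black G" "w \<in> white G" if "(c, b, w) \<in> edges G" for c b w
    using sub that by auto
  let ?H = "restrict_colors {1..D} G"
  \<comment> \<open>All edges of nonzero color at \<open>v\<close> lie in the bubble through
    \<open>v\<close>, where the facts on cyclic bubbles apply.\<close>
  have bubble: "\<exists>C p. cyclic_bubble D I p C \<and>
      (\<forall>c b w. (c, b, w) \<in> edges G \<and> c \<in> {1..D} \<and> (b = v \<or> w = v) \<longrightarrow> (c, b, w) \<in> edges C)"
    if v: "v \<in> verts G" for v
  proof -
    define S where "S = {u \<in> verts G. (v, u) \<in> (adj ?H)\<^sup>*}"
    have "induced_subgraph ?H S \<in> components ?H"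
      using v unfolding components_def S_def by auto
    then obtain p where "cyclic_bubble D I p (induced_subgraph ?H S)"
      using G unfolding gluings_def by blast
    moreover have "(c, b, w) \<in> edges (induced_subgraph ?H S)"
      if e: "(c, b, w) \<in> edges G" "c \<in> {1..D}" "b = v \<or> w = v" for c b w
    proof -
      have "(b, w) \<in> adj ?H" "(w, b) \<in> adj ?H" using e by (auto simp: adj_def)
      then show ?thesis using e endp[OF e(1)] by (auto simp: S_def verts_def)
    qed
    ultimately show ?thesis by blast
  qed
  have I1: "c \<in> {1..D}" if "c \<in> I" for c using that I_subset by auto
  \<comment> \<open>\<open>uI\<close> and \<open>uIc\<close> justify the definite descriptions in
    \<open>bubble_succ\<close>, which leave the color open.\<close>
  have uI: "w = w'" if "(i, b, w) \<in> edges G" "(i', b, w') \<in> edges G" "i \<in> I" "i' \<in> I" for i i' b w w'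
    using bubble[of b] endp[OF that(1)] that I1 cyclic_bubble_I_edges unfolding verts_def
    by (metis UnI1)
  have uIc: "b = b'" if "(i, b, w) \<in> edges G" "(i', b', w) \<in> edges G"
    "i \<in> {1..D} - I" "i' \<in> {1..D} - I" for i i' b b' w
    using bubble[of w] endp[OF that(1)] that cyclic_bubble_compl_edges unfolding verts_def
    by (metis UnI2 Diff_iff)
  obtain i j where i: "i \<in> I" "i \<in> {0..D}" and j: "j \<in> {1..D} - I" "j \<in> {0..D}"
    using I_nonempty I_proper I_subset by fastforce
  have sI: "(c, b, w) \<in> edges G \<longleftrightarrow> w = s b" if c: "c \<in> I" "b \<in> black G" for c b w
  proof -
    have c0: "c \<in> {0..D}" using c I_subset by auto
    obtain w0 where w0: "(c, b, w0) \<in> edges G" using exB[OF c0 c(2)] by blast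
    have "s b = w0"
      unfolding s_def bubble_succ_def using c w0 uI by (auto intro!: the_equality)
    then show ?thesis using w0 unB[OF c0 c(2)] by blast
  qed
  have sIc: "(c, b, w) \<in> edges G \<longleftrightarrow> b = s w" if c: "c \<in> {1..D} - I" "w \<in> white G" for c b w
  proof -
    have c0: "c \<in> {0..D}" using c by auto
    obtain b0 where b0: "(c, b0, w) \<in> edges G" using exW[OF c0 c(2)] by blast
    have "w \<notin> black G" using c dis by auto
    then have "s w = b0"
      unfolding s_def bubble_succ_def using c b0 uIc by (auto intro!: the_equality)
    then show ?thesis using b0 unW[OF c0 c(2)] by blast
  qed
  have a0: "(0, v, u) \<in> edges G \<or> (0, u, v) \<in> edges G \<longleftrightarrow> u = a v" if v: "v \<in> verts G" for u v
  proof -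
    have "\<exists>!u. (0, v, u) \<in> edges G \<or> (0, u, v) \<in> edges G"
    proof (cases "v \<in> black G")
      case True
      moreover have "(0, u, v) \<notin> edges G" for u using endp[of 0 u v] True dis by blast
      ultimately show ?thesis using exB[of 0 v] unB[of 0 v] by (metis atLeastAtMost_iff le0)
    next
      case False
      then have "v \<in> white G" using v by (simp add: verts_def)
      moreover have "(0, v, u) \<notin> edges G" for u using endp[of 0 v u] False by blast
      ultimately show ?thesis using exW[of 0 v] unW[of 0 v] by (metis atLeastAtMost_iff le0)
    qed
    from theI'[OF this] this show ?thesis
      using v unfolding a_def zero_partner_def by (auto)
  qed
  have aB: "(0, b, w) \<in> edges G \<longleftrightarrow> w = a b" if "b \<in> black G" for b w
    using a0[of b w] that endp[of 0 w b] dis by (auto simp: verts_def)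
  \<comment> \<open>Off the vertices \<open>zero_partner\<close> is the identity, so the law holds
    for every \<open>h\<close>.\<close>
  have aa: "a (a h) = h" for h
  proof (cases "h \<in> verts G")
    case True
    then have "(0, h, a h) \<in> edges G \<or> (0, a h, h) \<in> edges G" by (simp add: a0)
    moreover from this have "a h \<in> verts G" using endp by (auto simp: verts_def)
    ultimately show ?thesis using a0[of "a h" h] by auto
  qed (simp add: a_def zero_partner_def)
  have a_img: "a ` black G = white G"
  proof (intro equalityI subsetI)
    fix w assume w: "w \<in> white G"
    then obtain b where "(0, b, w) \<in> edges G" using exW[of 0 w] by auto
    then show "w \<in> a ` black G" using aB endp by blast
  qed (use aB endp in blast)
  have s_img: "s ` black G = white G"
  proof (intro equalityI subsetI)
    fix w assume w: "w \<in> white G"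
    then obtain b where "(i, b, w) \<in> edges G" using exW[of i w] i by auto
    then show "w \<in> s ` black G" using sI i endp by blast
  qed (use sI i endp in blast)
  have s_img': "s ` white G = black G"
  proof (intro equalityI subsetI)
    fix b assume b: "b \<in> black G"
    then obtain w where "(j, b, w) \<in> edges G" using exB[of j b] j by auto
    then show "b \<in> s ` white G" using sIc j endp by blast
  qed (use sIc j endp in blast)
  \<comment> \<open>Injectivity is obtained by counting: a surjection of a finite set onto itself is
    bijective.\<close>
  have permutes: "f permutes black G \<union> white G"
    if "f ` black G = white G" "f ` white G = black G" "\<And>x. x \<notin> verts G \<Longrightarrow> f x = x" for f
  proof (rule bij_imp_permutes)
    have "f ` (black G \<union> white G) = black G \<union> white G" using that by auto
    then show "bij_betw f (black G \<union> white G) (black G \<union> white G)"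
      using fin by (simp add: bij_betw_def eq_card_imp_inj_on)
  qed (use that in \<open>auto simp: verts_def\<close>)
  have a_img': "a ` white G = black G"
    unfolding a_img[symmetric] by (simp add: image_image aa)
  show alt: "alternating_gluing D I (black G) (white G) s a"
  proof unfold_locales
    show "s permutes black G \<union> white G"
      using s_img s_img' by (rule permutes) (auto simp: s_def bubble_succ_def verts_def)
    show "a permutes black G \<union> white G"
      using a_img a_img' by (rule permutes) (auto simp: a_def zero_partner_def)
  qed (use fin dis s_img s_img' a_img aa in auto)
  interpret alternating_gluing D I "black G" "white G" s a by (rule alt)
  have "(c, b, w) \<in> edges G \<longleftrightarrow> (c, b, w) \<in> edges \<G>" for c b w
  proof -
    consider "c = 0" | "c \<in> I" | "c \<in> {1..D} - I" | "c \<notin> {0..D}" by (cases "c = 0") auto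
    then show ?thesis
    proof cases
      case 1
      then show ?thesis using aB[of b w] endp[of c b w] zero_notin_I by (auto simp: edges_perm_graph)
    next
      case 2
      then show ?thesis using sI[of c b w] endp[of c b w] zero_notin_I by (auto simp: edges_perm_graph)
    next
      case 3
      then show ?thesis using sIc[of c w b] endp[of c b w] by (auto simp: edges_perm_graph)
    next
      case 4
      then show ?thesis using endp[of c b w] I_subset by (auto simp: edges_perm_graph)
    qed
  qed
  then have "edges \<G> = edges G" by auto
  then show "\<G> = G" by (simp add: perm_graph_def)
qed

section \<open>Recovering the data from a face-bipartite map\<close>

lemma face_bipartite_map_alternating:
  assumes M: "M \<in> face_bipartite_maps"
  defines "B \<equiv> \<Union> (faces2 M)" and "W \<equiv> \<Union> (faces1 M)"
  shows "alternating_gluing D I B W (sigma M) (alpha M)"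
    and "perm_map B W (sigma M) (alpha M) = M"
proof -
  let ?H = "half_edges M" and ?s = "sigma M" and ?a = "alpha M"
  have fin: "finite ?H" and s: "?s permutes ?H" and a: "?a permutes ?H"
    and inv: "\<And>h. h \<in> ?H \<Longrightarrow> ?a (?a h) = h"
    using M by (auto simp: face_bipartite_maps_def comb_map_def)
  have faces: "faces1 M \<union> faces2 M = face M ` ?H" "faces1 M \<inter> faces2 M = {}"
    and colors: "\<And>h. h \<in> ?H \<Longrightarrow>
      face M h \<in> faces1 M \<and> face M (?a h) \<in> faces2 M \<or>
      face M h \<in> faces2 M \<and> face M (?a h) \<in> faces1 M"
    using M by (auto simp: face_bipartite_maps_def face_bipartite_def)
  have face: "?s \<circ> ?a permutes ?H" by (rule permutes_compose[OF a s])
  have perm: "permutation (?s \<circ> ?a)" using face fin by (auto simp: permutation_permutes)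
  have self: "h \<in> face M h" for h
    unfolding face_def by (rule permutation_self_in_orbit[OF perm])
  have face_eq: "face M g = face M h" if "g \<in> face M h" for g h
    using cyclic_on_orbit'[OF perm, of h] that unfolding face_def by (rule orbit_cyclic_eq3)
  have sub: "face M h \<subseteq> ?H" if "h \<in> ?H" for h
    unfolding face_def by (rule permutes_orbit_subset[OF face that])
  \<comment> \<open>Faces are orbits, hence equal as soon as they meet: a half-edge covered by a
    family of faces has its own face in that family.\<close>
  have color: "h \<in> \<Union> A \<longleftrightarrow> h \<in> ?H \<and> face M h \<in> A" if A: "A \<subseteq> face M ` ?H" for h A
  proof
    assume "h \<in> \<Union> A"
    then obtain g where "g \<in> ?H" "h \<in> face M g" "face M g \<in> A" using A by blast
    then show "h \<in> ?H \<and> face M h \<in> A" using face_eq[of h g] sub[of g] by auto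
  qed (use self in blast)
  have W: "h \<in> W \<longleftrightarrow> h \<in> ?H \<and> face M h \<in> faces1 M" for h
    unfolding W_def by (rule color) (use faces(1) in blast)
  have B: "h \<in> B \<longleftrightarrow> h \<in> ?H \<and> face M h \<in> faces2 M" for h
    unfolding B_def by (rule color) (use faces(1) in blast)
  have aH: "?a h \<in> ?H" if "h \<in> ?H" for h using a that by (simp add: permutes_in_image)
  have sH: "?s h \<in> ?H" if "h \<in> ?H" for h using s that by (simp add: permutes_in_image)
  have BW: "B \<union> W = ?H" and dis: "B \<inter> W = {}"
    using W B faces(2) colors by blast+
  have aB: "?a h \<in> W" if "h \<in> B" for h
    using that colors[of h] aH[of h] faces(2) unfolding W B by blast
  have aW: "?a h \<in> B" if "h \<in> W" for h
    using that colors[of h] aH[of h] faces(2) unfolding W B by blast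
  \<comment> \<open>\<open>sigma M h\<close> is the image of \<open>alpha M h\<close> under
    \<open>sigma M \<circ> alpha M\<close>, so it lies on the face across the edge of
    \<open>h\<close>, which has the other color.\<close>
  have face_s: "face M (?s h) = face M (?a h)" if "h \<in> ?H" for h
  proof (rule face_eq)
    show "?s h \<in> face M (?a h)"
      using orbit.base[of "?s \<circ> ?a" "?a h"] inv[OF that] by (simp add: face_def)
  qed
  have sB: "?s h \<in> W" if "h \<in> B" for h
    using aB[OF that] face_s[of h] that sH[of h] unfolding W B by simp
  have sW: "?s h \<in> B" if "h \<in> W" for h
    using aW[OF that] face_s[of h] that sH[of h] unfolding W B by simp
  have image: "f ` B = W" "f ` W = B"
    if f: "f permutes ?H" "\<And>h. h \<in> B \<Longrightarrow> f h \<in> W" "\<And>h. h \<in> W \<Longrightarrow> f h \<in> B" for f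
  proof -
    \<comment> \<open>The two images lie in disjoint classes and together cover both, so neither
      inclusion can be strict.\<close>
    have "X = W \<and> Y = B" if "X \<union> Y = B \<union> W" "X \<subseteq> W" "Y \<subseteq> B" for X Y
      using that dis by blast
    moreover have "f ` B \<union> f ` W = B \<union> W"
      unfolding image_Un[symmetric] BW by (rule permutes_image[OF f(1)])
    moreover have "f ` B \<subseteq> W" "f ` W \<subseteq> B" using f(2,3) by (simp_all add: image_subset_iff)
    ultimately show "f ` B = W" "f ` W = B" by simp_all
  qed
  show alt: "alternating_gluing D I B W ?s ?a"
  proof unfold_locales
    show "?a (?a h) = h" for h
      using inv[of h] a by (cases "h \<in> ?H") (simp_all add: permutes_not_in)
    show "finite B" "finite W" using fin BW by (auto intro: finite_subset)
  qed (use image[OF s sB sW] image[OF a aB aW] s a dis BW in auto)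
  have face_Union: "face M ` \<Union> A = A" if A: "A \<subseteq> face M ` ?H" for A
  proof (intro equalityI subsetI)
    fix F assume "F \<in> A"
    then obtain h where "h \<in> ?H" "F = face M h" using A by blast
    then show "F \<in> face M ` \<Union> A" using \<open>F \<in> A\<close> self by blast
  next
    fix F assume "F \<in> face M ` \<Union> A"
    then show "F \<in> A" using color[OF A] by auto
  qed
  have "faces1 M \<subseteq> face M ` ?H" "faces2 M \<subseteq> face M ` ?H"
    unfolding faces(1)[symmetric] by simp_all
  then have "face M ` W = faces1 M" "face M ` B = faces2 M"
    unfolding W_def B_def by (simp_all only: face_Union)
  then have "orbit (?s \<circ> ?a) ` W = faces1 M" "orbit (?s \<circ> ?a) ` B = faces2 M"
    by (simp_all add: face_def)
  then show "perm_map B W ?s ?a = M" using BW by (simp add: perm_map_def)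
qed

section \<open>\<open>Mstar\<close> on gluings and on isomorphism classes\<close>

lemma Mstar_gluing:
  assumes "G \<in> gluings D I"
  shows "Mstar D I G = perm_map (black G) (white G) (bubble_succ D I G) (zero_partner G)"
  using alternating_gluing.Mstar_perm_graph[OF gluing_alternating(1)[OF assms]]
  by (simp add: gluing_alternating(2)[OF assms])

lemma Mstar_in_face_bipartite_maps:
  assumes "G \<in> gluings D I"
  shows "Mstar D I G \<in> face_bipartite_maps"
  using alternating_gluing.perm_map_in_face_bipartite_maps[OF gluing_alternating(1)[OF assms]] assms
  by (simp add: gluing_alternating(2)[OF assms] Mstar_gluing)

text \<open>The same \<open>f\<close> serves on both sides because the half-edges of the map are the
  vertices of the gluing.\<close>

lemma Mstar_iso_iff:
  assumes "G \<in> gluings D I" "G' \<in> gluings D I"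
  shows "fmap_iso (Mstar D I G) (Mstar D I G') f \<longleftrightarrow> cgraph_iso G G' f"
proof -
  note alt = gluing_alternating(1)[OF assms(1)] gluing_alternating(1)[OF assms(2)]
  show ?thesis
    using cgraph_iso_imp_fmap_iso[OF alt, of f] fmap_iso_imp_cgraph_iso[OF alt, of f]
    unfolding gluing_alternating(2)[OF assms(1)] gluing_alternating(2)[OF assms(2)]
      Mstar_gluing[OF assms(1)] Mstar_gluing[OF assms(2)] by blast
qed

text \<open>Equality is reached, not only isomorphism, since the preimage is built on the half-edges
  of \<open>M\<close> themselves.\<close>

lemma Mstar_surj:
  assumes M: "M \<in> face_bipartite_maps"
  shows "\<exists>G\<in>gluings D I. Mstar D I G = M"
proof -
  let ?B = "\<Union> (faces2 M)" and ?W = "\<Union> (faces1 M)"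
  interpret alternating_gluing D I ?B ?W "sigma M" "alpha M"
    by (rule face_bipartite_map_alternating(1)[OF M])
  have map: "perm_map ?B ?W (sigma M) (alpha M) = M"
    by (rule face_bipartite_map_alternating(2)[OF M])
  have "half_edges (perm_map ?B ?W (sigma M) (alpha M)) = ?B \<union> ?W"
    by (simp add: perm_map_def)
  then have "?B \<union> ?W = half_edges M" by (simp only: map)
  then have "\<G> \<in> gluings D I"
    using M by (simp only: perm_graph_in_gluings_iff map face_bipartite_maps_def mem_Collect_eq) simp
  moreover have "Mstar D I \<G> = M" by (simp only: Mstar_perm_graph map)
  ultimately show ?thesis by blast
qed

end

text \<open>Preserving the relation makes the map well defined on classes, and reflecting it makes
  the map injective. The union over a class \<open>C\<close> is one of equal sets, so it just picks
  their common value.\<close>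

lemma bij_betw_quotient:
  assumes R: "equiv A R" and S: "equiv B S"
    and F: "\<And>x. x \<in> A \<Longrightarrow> F x \<in> B"
    and iff: "\<And>x y. x \<in> A \<Longrightarrow> y \<in> A \<Longrightarrow> (F x, F y) \<in> S \<longleftrightarrow> (x, y) \<in> R"
    and surj: "\<And>z. z \<in> B \<Longrightarrow> \<exists>x\<in>A. F x = z"
  shows "(\<lambda>x. S `` {F x}) respects R"
    and "bij_betw (\<lambda>C. \<Union>x\<in>C. S `` {F x}) (A // R) (B // S)"
proof -
  show resp: "(\<lambda>x. S `` {F x}) respects R"
  proof (rule congruentI)
    fix x y assume xy: "(x, y) \<in> R"
    have "x \<in> A" "y \<in> A" using subsetD[OF equiv_type[OF R] xy] by simp_all
    then have "(F x, F y) \<in> S" using xy by (simp only: iff)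
    then show "S `` {F x} = S `` {F y}" by (rule equiv_class_eq[OF S])
  qed
  have cls: "(\<Union>x\<in>R `` {y}. S `` {F x}) = S `` {F y}" if "y \<in> A" for y
    by (rule UN_equiv_class[OF R resp that])
  show "bij_betw (\<lambda>C. \<Union>x\<in>C. S `` {F x}) (A // R) (B // S)"
    unfolding bij_betw_def
  proof
    show "inj_on (\<lambda>C. \<Union>x\<in>C. S `` {F x}) (A // R)"
    proof (rule inj_onI)
      fix X Y assume "X \<in> A // R" "Y \<in> A // R" and eq: "(\<Union>x\<in>X. S `` {F x}) = (\<Union>x\<in>Y. S `` {F x})"
      then obtain x y where xy: "x \<in> A" "y \<in> A" "X = R `` {x}" "Y = R `` {y}"
        by (auto elim!: quotientE)
      then have "S `` {F x} = S `` {F y}" using eq by (simp only: cls)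
      then have "(F x, F y) \<in> S"
        using eq_equiv_class[OF _ S F] xy by blast
      then have "(x, y) \<in> R" using xy by (simp only: iff)
      then show "X = Y" unfolding xy by (rule equiv_class_eq[OF R])
    qed
    show "(\<lambda>C. \<Union>x\<in>C. S `` {F x}) ` (A // R) = B // S"
    proof (intro equalityI subsetI)
      fix Z assume "Z \<in> (\<lambda>C. \<Union>x\<in>C. S `` {F x}) ` (A // R)"
      then obtain C where "C \<in> A // R" "Z = (\<Union>x\<in>C. S `` {F x})" by blast
      then obtain x where "x \<in> A" "Z = S `` {F x}" using cls by (elim quotientE) simp
      then show "Z \<in> B // S" using F by (simp add: quotientI)
    next
      fix Z assume "Z \<in> B // S"
      then obtain z where "z \<in> B" "Z = S `` {z}" by (rule quotientE)
      moreover from surj[OF this(1)] obtain x where "x \<in> A" "F x = z" by blast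
      ultimately show "Z \<in> (\<lambda>C. \<Union>x\<in>C. S `` {F x}) ` (A // R)"
        using cls by (intro image_eqI[of _ _ "R `` {x}"]) (simp_all add: quotientI)
    qed
  qed
qed

theorem proposition2p1p3:
  fixes D k :: nat and I :: "nat set"
  assumes "D \<ge> 2" and "0 < k" and "k \<le> D div 2"
    and "I \<subseteq> {1..D}" and "card I = k"
  shows "Mstar D I ` (gluings D I :: 'v cgraph set) \<subseteq> face_bipartite_maps
    \<and> (\<lambda>G :: 'v cgraph. fmap_rel `` {Mstar D I G}) respects gluing_rel D I
    \<and> bij_betw (\<lambda>C :: 'v cgraph set. \<Union>G\<in>C. fmap_rel `` {Mstar D I G})
        (gluings D I // gluing_rel D I) (face_bipartite_maps // fmap_rel)"
proof -
  have "finite I" using \<open>I \<subseteq> {1..D}\<close> by (rule finite_subset) simp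
  then have "card ({1..D} - I) = D - k" using assms by (simp add: card_Diff_subset)
  \<comment> \<open>From \<open>k \<le> D div 2\<close> and \<open>D \<ge> 2\<close> follows
    \<open>k < D\<close>, so the complement contains a color; \<open>0 < k\<close> provides one in
    \<open>I\<close>.\<close>
  then have "card ({1..D} - I) > 0" using assms by simp
  then interpret color_split D I
    using assms by unfold_locales (auto simp: card_gt_0_iff)
  have "(Mstar D I G, Mstar D I G') \<in> fmap_rel \<longleftrightarrow> (G, G') \<in> gluing_rel D I"
    if "G \<in> gluings D I" "G' \<in> gluings D I" for G G' :: "'v cgraph"
  proof -
    have "(\<exists>f. fmap_iso (Mstar D I G) (Mstar D I G') f) \<longleftrightarrow> (\<exists>f. cgraph_iso G G' f)"
      using Mstar_iso_iff[OF that] by blast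
    then show ?thesis
      using that by (simp add: fmap_rel_def gluing_rel_def Mstar_in_face_bipartite_maps)
  qed
  from bij_betw_quotient[OF equiv_gluing_rel equiv_fmap_rel Mstar_in_face_bipartite_maps this
      Mstar_surj]
  show ?thesis
    using Mstar_in_face_bipartite_maps by blast
qed

end
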